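(* Let $R$ be an integral domain (not a field) that is finitely stable and an LPI-domain. Assume that every nonzero finitely generated ideal $I$ of $R$ is principal as an ideal of its endomorphism ring $E(I)=(I:I)$, i.e. $I=xE(I)$ for some $x\in I$. Then $R$ has finite character.
   Context: Let $R$ be an integral domain with quotient field $K\neq R$. For a nonzero (fractional) ideal $I$ of $R$, $(I:I)=\{x\in K: xI\subseteq I\}$ and $E(I):=(I:I)$ is its endomorphism ring. An ideal $I$ is locally principal if $IR_M$ is principal for every maximal ideal $M$ of $R$; it is invertible if $I(R:I)=R$, where $(R:I)=\{x\in K: xI\subseteq R\}$. $R$ is an LPI-domain if every locally principal nonzero ideal of $R$ is invertible. A nonzero ideal $I$ is stable if it is invertible as an ideal of the ring $E(I)$; $R$ is finitely stable if every nonzero finitely generated ideal of $R$ is stable. $R$ has finite character if every nonzero element of $R$ lies in only finitely many maximal ideals of $R$. *)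

theory Defs
  imports Main
begin

text \<open>An integral domain R is modelled as a subring of a field of type 'k
which is its quotient field.\<close>

definition subring :: "'k::field set \<Rightarrow> bool" where
  "subring R \<longleftrightarrow> 0 \<in> R \<and> 1 \<in> R \<and> (\<forall>a\<in>R. \<forall>b\<in>R. a + b \<in> R \<and> a - b \<in> R \<and> a * b \<in> R)"

definition is_quotient_field_of :: "'k::field set \<Rightarrow> bool" where
  "is_quotient_field_of R \<longleftrightarrow> subring R \<and> (\<forall>x::'k. \<exists>a\<in>R. \<exists>b\<in>R. b \<noteq> 0 \<and> x = a / b)"

definition ideal_of :: "'k::field set \<Rightarrow> 'k set \<Rightarrow> bool" where
  "ideal_of R I \<longleftrightarrow> I \<subseteq> R \<and> 0 \<in> I \<and> (\<forall>a\<in>I. \<forall>b\<in>I. a + b \<in> I) \<and> (\<forall>r\<in>R. \<forall>a\<in>I. r * a \<in> I)"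

definition fg_ideal :: "'k::field set \<Rightarrow> 'k set \<Rightarrow> bool" where
  "fg_ideal R I \<longleftrightarrow> ideal_of R I \<and>
     (\<exists>F. finite F \<and> F \<subseteq> R \<and> I = {\<Sum>g\<in>F. c g * g | c. \<forall>g\<in>F. c g \<in> R})"

definition maximal_ideal :: "'k::field set \<Rightarrow> 'k set \<Rightarrow> bool" where
  "maximal_ideal R M \<longleftrightarrow> ideal_of R M \<and> M \<noteq> R \<and>
     (\<forall>J. ideal_of R J \<and> M \<subseteq> J \<and> J \<noteq> R \<longrightarrow> J = M)"

definition setmult :: "'k::field set \<Rightarrow> 'k set \<Rightarrow> 'k set" where
  "setmult A B = {\<Sum>i<(n::nat). a i * b i | n a b. \<forall>i<n. a i \<in> A \<and> b i \<in> B}"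

definition colon :: "'k::field set \<Rightarrow> 'k set \<Rightarrow> 'k set" where
  "colon A B = {x. \<forall>y\<in>B. x * y \<in> A}"

definition endo :: "'k::field set \<Rightarrow> 'k set" where
  "endo I = colon I I"

definition localization :: "'k::field set \<Rightarrow> 'k set \<Rightarrow> 'k set" where
  "localization R M = {a / s | a s. a \<in> R \<and> s \<in> R \<and> s \<notin> M}"

definition principal_in :: "'k::field set \<Rightarrow> 'k set \<Rightarrow> bool" where
  "principal_in S J \<longleftrightarrow> (\<exists>x. J = {x * s | s. s \<in> S})"

definition locally_principal :: "'k::field set \<Rightarrow> 'k set \<Rightarrow> bool" where
  "locally_principal R I \<longleftrightarrow>
     (\<forall>M. maximal_ideal R M \<longrightarrow> principal_in (localization R M) (setmult I (localization R M)))"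

definition invertible_in :: "'k::field set \<Rightarrow> 'k set \<Rightarrow> bool" where
  "invertible_in S I \<longleftrightarrow> setmult I (colon S I) = S"

definition LPI_domain :: "'k::field set \<Rightarrow> bool" where
  "LPI_domain R \<longleftrightarrow> (\<forall>I. ideal_of R I \<and> I \<noteq> {0} \<and> locally_principal R I \<longrightarrow> invertible_in R I)"

definition stable_ideal :: "'k::field set \<Rightarrow> bool" where
  "stable_ideal I \<longleftrightarrow> invertible_in (endo I) I"

definition finitely_stable :: "'k::field set \<Rightarrow> bool" where
  "finitely_stable R \<longleftrightarrow> (\<forall>I. fg_ideal R I \<and> I \<noteq> {0} \<longrightarrow> stable_ideal I)"

definition finite_character :: "'k::field set \<Rightarrow> bool" where
  "finite_character R \<longleftrightarrow> (\<forall>x\<in>R. x \<noteq> 0 \<longrightarrow> finite {M. maximal_ideal R M \<and> x \<in> M})"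

end

(*
  If I = x E(I) with x in I, then I^2 = x I lies in xR; so replacing a finitely generated ideal I
  by the principal ideal xR does not change the maximal ideals above it, and x divides d^2 for
  every d in I.

  If d <> 0 lies in infinitely many maximal ideals, there are infinitely many proper finitely
  generated ideals containing d, no two of which lie in a common maximal ideal.  If every proper
  finitely generated ideal above d can be enlarged to one with a unique maximal ideal above it,
  these enlargements do; otherwise some ideal can be split again and again into two comaximal ones.

  Their generators x_0, x_1, ... in the above sense are pairwise comaximal nonunits dividing
  e = d^2.  The union A of the increasing chain of principal ideals (e / (x_0 ... x_(n-1))) R is
  locally principal, because a maximal ideal contains at most one x_k.  But A is not finitely
  generated, because the chain never becomes stationary, and so A is not invertible.
*)

theory Submission
  imports Defs
begin

context
  fixes R :: "'k::field set"
  assumes subring: "subring R"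
begin

section \<open>Ideals, maximal ideals and comaximality in a subring of a field\<close>

lemma subring_closed:
  shows "0 \<in> R" "1 \<in> R"
    and "a \<in> R \<Longrightarrow> b \<in> R \<Longrightarrow> a + b \<in> R"
    and "a \<in> R \<Longrightarrow> b \<in> R \<Longrightarrow> a - b \<in> R"
    and "a \<in> R \<Longrightarrow> b \<in> R \<Longrightarrow> a * b \<in> R"
  using subring by (auto simp: subring_def)

lemma subring_prod: "(\<And>i. i \<in> S \<Longrightarrow> f i \<in> R) \<Longrightarrow> prod f S \<in> R"
  by (induction S rule: infinite_finite_induct) (auto intro: subring_closed)

lemma ideal_sum:
  assumes "ideal_of R I" "\<And>i. i \<in> S \<Longrightarrow> f i \<in> I"
  shows "sum f S \<in> I"
  using assms(2)
  by (induction S rule: infinite_finite_induct) (use assms(1) in \<open>auto simp: ideal_of_def\<close>)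

lemma ideal_eq_R_iff: "ideal_of R I \<Longrightarrow> I = R \<longleftrightarrow> 1 \<in> I"
  unfolding ideal_of_def using subring_closed(2) by force

lemma ideal_sum_ideal:
  assumes I: "ideal_of R I" and J: "ideal_of R J"
  shows "ideal_of R {a + b | a b. a \<in> I \<and> b \<in> J}"
  unfolding ideal_of_def
proof (intro conjI ballI)
  show "{a + b | a b. a \<in> I \<and> b \<in> J} \<subseteq> R"
    using I J by (auto simp: ideal_of_def intro!: subring_closed)
  show "0 \<in> {a + b | a b. a \<in> I \<and> b \<in> J}"
    using I J by (force simp: ideal_of_def)
next
  fix x y assume "x \<in> {a + b | a b. a \<in> I \<and> b \<in> J}" "y \<in> {a + b | a b. a \<in> I \<and> b \<in> J}"
  then obtain a b a' b' where "x = a + b" "y = a' + b'" "a \<in> I" "b \<in> J" "a' \<in> I" "b' \<in> J"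
    by blast
  moreover from this have "x + y = (a + a') + (b + b')" by simp
  moreover have "a + a' \<in> I" "b + b' \<in> J"
    using calculation I J by (auto simp: ideal_of_def)
  ultimately show "x + y \<in> {a + b | a b. a \<in> I \<and> b \<in> J}" by blast
next
  fix r x assume "r \<in> R" "x \<in> {a + b | a b. a \<in> I \<and> b \<in> J}"
  then obtain a b where "x = a + b" "a \<in> I" "b \<in> J" by blast
  moreover from this have "r * x = r * a + r * b" by (simp add: distrib_left)
  moreover have "r * a \<in> I" "r * b \<in> J"
    using calculation I J \<open>r \<in> R\<close> by (auto simp: ideal_of_def)
  ultimately show "r * x \<in> {a + b | a b. a \<in> I \<and> b \<in> J}" by blast
qed

lemma principal_ideal: "a \<in> R \<Longrightarrow> ideal_of R {r * a | r. r \<in> R}"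
  unfolding ideal_of_def
proof (intro conjI ballI)
  assume a: "a \<in> R"
  show "{r * a | r. r \<in> R} \<subseteq> R" using a by (auto intro: subring_closed)
  show "0 \<in> {r * a | r. r \<in> R}" using subring_closed(1) by force
  show "x + y \<in> {r * a | r. r \<in> R}"
    if "x \<in> {r * a | r. r \<in> R}" "y \<in> {r * a | r. r \<in> R}" for x y
    using that by (auto simp flip: distrib_right) (blast intro: subring_closed)
  show "s * x \<in> {r * a | r. r \<in> R}" if "s \<in> R" "x \<in> {r * a | r. r \<in> R}" for s x
    using that by (auto simp flip: mult.assoc) (blast intro: subring_closed)
qed

lemma maximal_ideal_one: "maximal_ideal R M \<Longrightarrow> 1 \<notin> M"
  using ideal_eq_R_iff by (auto simp: maximal_ideal_def)

lemma maximal_ideal_add_ideal: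
  assumes M: "maximal_ideal R M" and J: "ideal_of R J" and "\<not> J \<subseteq> M"
  obtains m j where "m \<in> M" "j \<in> J" "m + j = 1"
proof -
  define S where "S = {a + b | a b. a \<in> M \<and> b \<in> J}"
  have idM: "ideal_of R M" using M by (simp add: maximal_ideal_def)
  have S: "ideal_of R S" unfolding S_def by (rule ideal_sum_ideal[OF idM J])
  have zero: "0 \<in> M" "0 \<in> J" using idM J by (simp_all add: ideal_of_def)
  have "m \<in> S" if "m \<in> M" for m
  proof -
    have "m = m + 0" by simp
    then show ?thesis unfolding S_def using \<open>m \<in> M\<close> zero(2) by blast
  qed
  moreover have "j \<in> S" if "j \<in> J" for j
  proof -
    have "j = 0 + j" by simp
    then show ?thesis unfolding S_def using \<open>j \<in> J\<close> zero(1) by blast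
  qed
  ultimately have "M \<subseteq> S" "J \<subseteq> S" by blast+
  then have "S \<noteq> M" using \<open>\<not> J \<subseteq> M\<close> by blast
  then have "S = R" using M S \<open>M \<subseteq> S\<close> unfolding maximal_ideal_def by blast
  then obtain m j where "m \<in> M" "j \<in> J" "1 = m + j"
    using subring_closed(2) unfolding S_def by blast
  then show ?thesis using that by simp
qed

lemma maximal_ideal_prime:
  assumes M: "maximal_ideal R M" and "a \<in> R" "b \<in> R" "a * b \<in> M"
  shows "a \<in> M \<or> b \<in> M"
proof (rule ccontr)
  assume "\<not> (a \<in> M \<or> b \<in> M)"
  moreover have "a \<in> {r * a | r. r \<in> R}" using subring_closed(2) by force
  ultimately have "\<not> {r * a | r. r \<in> R} \<subseteq> M" by blast
  from maximal_ideal_add_ideal[OF M principal_ideal[OF \<open>a \<in> R\<close>] this]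
  obtain m r where "m \<in> M" "r \<in> R" "m + r * a = 1" by blast
  then have "b = b * m + r * (a * b)"
    by (metis distrib_left mult.commute mult.left_commute mult.right_neutral)
  moreover have "b * m \<in> M" "r * (a * b) \<in> M"
    using M \<open>m \<in> M\<close> \<open>r \<in> R\<close> assms(3,4) by (auto simp: maximal_ideal_def ideal_of_def)
  ultimately have "b \<in> M"
    using M unfolding maximal_ideal_def ideal_of_def by metis
  then show False using \<open>\<not> (a \<in> M \<or> b \<in> M)\<close> by blast
qed

lemma maximal_ideal_prod:
  assumes M: "maximal_ideal R M" and "finite S" "\<And>i. i \<in> S \<Longrightarrow> f i \<in> R" "prod f S \<in> M"
  shows "\<exists>i\<in>S. f i \<in> M"
  using assms(2-4)
proof (induction S)
  case empty
  then show ?case using maximal_ideal_one[OF M] by simp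
next
  case (insert i S)
  then show ?case
    using maximal_ideal_prime[OF M, of "f i" "prod f S"] subring_prod[of S f] by auto
qed

lemma ideal_in_maximal_ideal:
  assumes I: "ideal_of R I" and "1 \<notin> I"
  obtains M where "maximal_ideal R M" "I \<subseteq> M"
proof -
  \<comment> \<open>Properness is put as \<open>1 \<notin> J\<close>, a condition that passes
    directly to unions of chains.\<close>
  let ?A = "{J. ideal_of R J \<and> I \<subseteq> J \<and> 1 \<notin> J}"
  have "\<exists>M\<in>?A. \<forall>X\<in>?A. M \<subseteq> X \<longrightarrow> X = M"
  proof (rule subset_Zorn_nonempty)
    show "?A \<noteq> {}" using assms by blast
  next
    fix C assume "C \<noteq> {}" and chain: "subset.chain ?A C"
    then have C: "C \<subseteq> ?A" by (simp add: subset.chain_def)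
    have "ideal_of R (\<Union>C)"
      unfolding ideal_of_def
    proof (intro conjI ballI)
      show "\<Union>C \<subseteq> R" "0 \<in> \<Union>C"
        using C \<open>C \<noteq> {}\<close> by (auto simp: ideal_of_def)
      show "a + b \<in> \<Union>C" if "a \<in> \<Union>C" "b \<in> \<Union>C" for a b
      proof -
        obtain X Y where XY: "X \<in> C" "a \<in> X" "Y \<in> C" "b \<in> Y"
          using \<open>a \<in> \<Union>C\<close> \<open>b \<in> \<Union>C\<close> by blast
        then have "X \<subseteq> Y \<or> Y \<subseteq> X" using chain by (auto simp: subset_chain_def)
        then obtain Z where "Z \<in> C" "a \<in> Z" "b \<in> Z" using XY by blast
        moreover from this have "ideal_of R Z" using C by blast
        ultimately show ?thesis unfolding ideal_of_def by blast
      qed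
      show "r * a \<in> \<Union>C" if "r \<in> R" "a \<in> \<Union>C" for r a
        using that C unfolding ideal_of_def by blast
    qed
    then show "\<Union>C \<in> ?A" using C \<open>C \<noteq> {}\<close> by blast
  qed
  then obtain M where "M \<in> ?A" and max: "\<forall>X\<in>?A. M \<subseteq> X \<longrightarrow> X = M" by blast
  then have "maximal_ideal R M"
    unfolding maximal_ideal_def using ideal_eq_R_iff by (auto intro: subring_closed)
  then show ?thesis using that \<open>M \<in> ?A\<close> by blast
qed

text \<open>If 1 were missing from aR + bR, some maximal ideal above that sum would contain both
  \<open>a\<close> and \<open>b\<close>.\<close>

lemma comaximal_elements:
  assumes "a \<in> R" "b \<in> R" "\<And>M. maximal_ideal R M \<Longrightarrow> \<not> (a \<in> M \<and> b \<in> M)"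
  obtains u v where "u \<in> R" "v \<in> R" "u * a + v * b = 1"
proof -
  define S where "S = {x + y | x y. x \<in> {r * a | r. r \<in> R} \<and> y \<in> {r * b | r. r \<in> R}}"
  have S: "ideal_of R S"
    unfolding S_def by (intro ideal_sum_ideal principal_ideal assms(1,2))
  have S_iff: "z \<in> S \<longleftrightarrow> (\<exists>u\<in>R. \<exists>v\<in>R. z = u * a + v * b)" for z
    unfolding S_def by blast
  have "a \<in> S"
    unfolding S_iff by (rule bexI[of _ 1], rule bexI[of _ 0]) (simp_all add: subring_closed)
  moreover have "b \<in> S"
    unfolding S_iff by (rule bexI[of _ 0], rule bexI[of _ 1]) (simp_all add: subring_closed)
  ultimately have "1 \<in> S"
    using ideal_in_maximal_ideal[OF S] assms(3) by (metis subsetD)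
  then obtain u v where "u \<in> R" "v \<in> R" "1 = u * a + v * b"
    unfolding S_iff by blast
  then show ?thesis using that[of u v] by simp
qed

section \<open>Local principality, and comaximal divisors in an LPI-domain\<close>

text \<open>The equation \<open>q * a = b * r\<close> with \<open>q \<notin> M\<close> is
  \<open>a = b * (r / q)\<close> in the localization, with the denominator cleared. Thus every
  \<open>a\<close> in \<open>A\<close> is locally a multiple of one \<open>b\<close> in
  \<open>A\<close>, and this \<open>b\<close> generates the extension of \<open>A\<close> at
  \<open>M\<close>.\<close>

lemma locally_principal_criterion:
  assumes A: "A \<subseteq> R"
    and loc: "\<And>M. maximal_ideal R M \<Longrightarrow>
      \<exists>b\<in>A. \<forall>a\<in>A. \<exists>q\<in>R. \<exists>r\<in>R. q \<notin> M \<and> q * a = b * r"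
  shows "locally_principal R A"
  unfolding locally_principal_def principal_in_def
proof (intro allI impI)
  fix M assume M: "maximal_ideal R M"
  let ?L = "localization R M"
  have M0: "0 \<in> M" using M by (simp add: maximal_ideal_def ideal_of_def)
  obtain b where "b \<in> A" and b: "\<And>a. a \<in> A \<Longrightarrow> \<exists>q\<in>R. \<exists>r\<in>R. q \<notin> M \<and> q * a = b * r"
    using loc[OF M] by blast
  have L_mem: "r / s \<in> ?L" if "r \<in> R" "s \<in> R" "s \<notin> M" for r s
    using that unfolding localization_def by blast
  have L0: "0 \<in> ?L"
    using L_mem[of 0 1] subring_closed(1,2) maximal_ideal_one[OF M] by simp
  have L_add: "x + y \<in> ?L" if "x \<in> ?L" "y \<in> ?L" for x y
  proof -
    obtain r s r' s' where *: "x = r / s" "y = r' / s'" "r \<in> R" "s \<in> R" "r' \<in> R" "s' \<in> R"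
      "s \<notin> M" "s' \<notin> M" using \<open>x \<in> ?L\<close> \<open>y \<in> ?L\<close> by (auto simp: localization_def)
    then have "s \<noteq> 0" "s' \<noteq> 0" using M0 by auto
    then have "x + y = (r * s' + r' * s) / (s * s')" using * by (simp add: add_frac_eq)
    moreover have "s * s' \<notin> M" using maximal_ideal_prime[OF M] * by blast
    ultimately show ?thesis using * by (simp add: L_mem subring_closed)
  qed
  have "a * t \<in> {b * s | s. s \<in> ?L}" if "a \<in> A" "t \<in> ?L" for a t
  proof -
    obtain r s where t: "t = r / s" "r \<in> R" "s \<in> R" "s \<notin> M"
      using \<open>t \<in> ?L\<close> by (auto simp: localization_def)
    obtain q r' where q: "q \<in> R" "r' \<in> R" "q \<notin> M" "q * a = b * r'"
      using b[OF \<open>a \<in> A\<close>] by blast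
    have "q \<noteq> 0" "s \<noteq> 0" using q t M0 by auto
    then have "a = b * r' / q" using q by (simp add: field_simps)
    then have "a * t = b * ((r' * r) / (q * s))" using t by simp
    moreover have "q * s \<notin> M" using maximal_ideal_prime[OF M] q t by blast
    ultimately show ?thesis using q t L_mem[of "r' * r" "q * s"] subring_closed(5) by blast
  qed
  note mult_mem = this
  have "(\<Sum>i<n. f i * g i) \<in> {b * s | s. s \<in> ?L}"
    if "\<forall>i<n. f i \<in> A \<and> g i \<in> ?L" for f g and n :: nat
    using that
  proof (induction n)
    case 0
    have "(\<Sum>i<0. f i * g i) = b * 0" by simp
    then show ?case using L0 by blast
  next
    case (Suc n)
    then obtain s where s: "s \<in> ?L" "(\<Sum>i<n. f i * g i) = b * s" by auto
    obtain s' where s': "s' \<in> ?L" "f n * g n = b * s'" using mult_mem Suc.prems by blast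
    have "(\<Sum>i<Suc n. f i * g i) = b * (s + s')" using s s' by (simp add: distrib_left)
    then show ?case using L_add s s' by blast
  qed
  moreover have "b * s \<in> setmult A ?L" if "s \<in> ?L" for s
  proof -
    have "b * s = (\<Sum>i<(1::nat). b * s) \<and> (\<forall>i<(1::nat). b \<in> A \<and> s \<in> ?L)"
      using that \<open>b \<in> A\<close> by simp
    then show ?thesis
      unfolding setmult_def
      by (intro CollectI exI[of _ "1::nat"], rule_tac exI[of _ "\<lambda>_. b"], rule_tac exI[of _ "\<lambda>_. s"])
  qed
  ultimately have "setmult A ?L = {b * s | s. s \<in> ?L}"
    unfolding setmult_def by blast
  then show "\<exists>b. setmult A ?L = {b * s | s. s \<in> ?L}" by blast
qed

text \<open>Writing 1 as an element of A(R:A) involves only finitely many elements of the union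
  \<open>A\<close>. They all lie in one member of the chain, and comparison with the next member
  puts the inverse of some \<open>x N\<close> into \<open>R\<close>.\<close>

lemma LPI_domain_no_comaximal_divisors:
  fixes x :: "nat \<Rightarrow> 'k"
  assumes LPI: "LPI_domain R"
    and "e \<noteq> 0" and x: "\<And>n. x n \<in> R"
    and div: "\<And>n. \<exists>r\<in>R. e = x n * r"
    and nonunit: "\<And>n. \<exists>M. maximal_ideal R M \<and> x n \<in> M"
    and comax: "\<And>i j M. maximal_ideal R M \<Longrightarrow> x i \<in> M \<Longrightarrow> x j \<in> M \<Longrightarrow> i = j"
  shows False
proof -
  define p where "p n = (\<Prod>i<n. x i)" for n
  have pSuc: "p (Suc n) = p n * x n" for n by (simp add: p_def)
  have p: "p n \<in> R" for n unfolding p_def by (intro subring_prod x)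
  have x0: "x n \<noteq> 0" for n using div[of n] \<open>e \<noteq> 0\<close> by auto
  then have p0: "p n \<noteq> 0" for n by (simp add: p_def)
  have p_dvd: "\<exists>r\<in>R. e = p n * r" for n
  proof (induction n)
    case 0
    \<comment> \<open>Here \<open>p 0\<close> is the empty product, so the claim amounts to
      \<open>e \<in> R\<close>, which holds because \<open>e\<close> is a multiple of
      \<open>x 0\<close>.\<close>
    show ?case using div[of 0] x[of 0] by (auto simp: p_def intro: subring_closed)
  next
    case (Suc n)
    then obtain r where r: "r \<in> R" "e = p n * r" by blast
    obtain s where s: "s \<in> R" "e = x n * s" using div by blast
    have "\<not> (p n \<in> M \<and> x n \<in> M)" if M: "maximal_ideal R M" for M
    proof
      assume *: "p n \<in> M \<and> x n \<in> M"
      then obtain i where "i < n" "x i \<in> M"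
        using maximal_ideal_prod[OF M, of "{..<n}" x] x unfolding p_def by blast
      then show False using comax[OF M, of i n] * by simp
    qed
    then obtain u v where uv: "u \<in> R" "v \<in> R" "u * p n + v * x n = 1"
      using comaximal_elements[OF p[of n] x[of n]] by blast
    \<comment> \<open>Multiply the Bezout identity by \<open>e\<close>, then replace
      \<open>e\<close> by \<open>x n * s\<close> in the summand with \<open>p n\<close> and by
      \<open>p n * r\<close> in the summand with \<open>x n\<close>. Both summands become multiples
      of \<open>p n * x n\<close>.\<close>
    have "e = u * p n * e + v * x n * e" using uv by (metis distrib_right mult_1)
    also have "\<dots> = u * p n * (x n * s) + v * x n * (p n * r)"
      using r(2) s(2) by metis
    also have "\<dots> = p (Suc n) * (u * s + v * r)"
      by (simp add: pSuc algebra_simps)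
    finally show ?case using uv r s by (blast intro: subring_closed)
  qed
  \<comment> \<open>This is the union of the principal ideals generated by the
    \<open>e / p n\<close>, with the division cleared.\<close>
  define A where "A = {a. \<exists>n. \<exists>r\<in>R. a * p n = e * r}"
  \<comment> \<open>The index of an element of \<open>A\<close> may be raised, so finitely many
    elements can be given a common index.\<close>
  have A_mono: "\<exists>r\<in>R. a * p (n + k) = e * r" if "\<exists>r\<in>R. a * p n = e * r" for a n k
  proof (induction k)
    case 0
    then show ?case using that by simp
  next
    case (Suc k)
    then obtain r where "r \<in> R" "a * p (n + k) = e * r" by blast
    then have "a * p (n + Suc k) = e * (r * x (n + k))"
      by (metis add_Suc_right mult.assoc pSuc)
    then show ?case using \<open>r \<in> R\<close> x by (blast intro: subring_closed)
  qed
  have A_le: "\<exists>r\<in>R. a * p m = e * r" if "\<exists>r\<in>R. a * p n = e * r" "n \<le> m" for a n m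
    using A_mono[OF that(1), of "m - n"] that(2) by simp
  \<comment> \<open>Since \<open>p n\<close> divides \<open>e\<close> in \<open>R\<close>, each
    generator \<open>e / p n\<close> lies in \<open>R\<close>.\<close>
  have A_sub: "A \<subseteq> R"
  proof
    fix a assume "a \<in> A"
    then obtain n r where n: "r \<in> R" "a * p n = e * r" unfolding A_def by blast
    obtain s where "s \<in> R" "e = p n * s" using p_dvd by blast
    then have "a = s * r" using n p0[of n] by simp
    then show "a \<in> R" using \<open>s \<in> R\<close> \<open>r \<in> R\<close> by (auto intro: subring_closed)
  qed
  have A: "ideal_of R A"
    unfolding ideal_of_def
  proof (intro conjI ballI A_sub)
    show "0 \<in> A" unfolding A_def using subring_closed(1) by force
  next
    fix a b assume "a \<in> A" "b \<in> A"
    then obtain n m where "\<exists>r\<in>R. a * p n = e * r" "\<exists>r\<in>R. b * p m = e * r"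
      unfolding A_def by blast
    then have "\<exists>r\<in>R. a * p (max n m) = e * r" "\<exists>r\<in>R. b * p (max n m) = e * r"
      using A_le by (meson max.cobounded1 max.cobounded2)+
    then obtain r s where "r \<in> R" "s \<in> R" "a * p (max n m) = e * r" "b * p (max n m) = e * s"
      by blast
    then have "(a + b) * p (max n m) = e * (r + s)" by (simp add: distrib_left distrib_right)
    then show "a + b \<in> A" unfolding A_def using \<open>r \<in> R\<close> \<open>s \<in> R\<close>
      by (blast intro: subring_closed)
  next
    fix r a assume "r \<in> R" "a \<in> A"
    then obtain n s where "s \<in> R" "a * p n = e * s" unfolding A_def by blast
    then have "r * a * p n = e * (r * s)" by (simp add: mult.assoc mult.left_commute)
    then show "r * a \<in> A" unfolding A_def using \<open>r \<in> R\<close> \<open>s \<in> R\<close>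
      by (blast intro: subring_closed)
  qed
  have e_div_p: "e / p n \<in> A" for n
  proof -
    have "e / p n * p n = e * 1" using p0[of n] by simp
    then show ?thesis unfolding A_def using subring_closed(2) by blast
  qed
  have "locally_principal R A"
  proof (rule locally_principal_criterion[OF A_sub])
    fix M assume M: "maximal_ideal R M"
    show "\<exists>b\<in>A. \<forall>a\<in>A. \<exists>q\<in>R. \<exists>r\<in>R. q \<notin> M \<and> q * a = b * r"
    \<comment> \<open>If \<open>M\<close> contains no \<open>x k\<close>, it contains no
      \<open>p n\<close>, and \<open>e\<close> generates \<open>A\<close> locally. Otherwise it
      contains exactly one \<open>x k\<close>, and the local generator is
      \<open>e / x k\<close>.\<close>
    proof (cases "\<exists>k. x k \<in> M")
      case False
      have "\<exists>q\<in>R. \<exists>r\<in>R. q \<notin> M \<and> q * a = e * r" if "a \<in> A" for a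
      proof -
        obtain n r where "r \<in> R" "a * p n = e * r"
          using \<open>a \<in> A\<close> unfolding A_def by blast
        moreover have "p n \<notin> M"
          using maximal_ideal_prod[OF M, of "{..<n}" x] x False unfolding p_def by blast
        ultimately show ?thesis using p by (metis mult.commute)
      qed
      moreover have "e \<in> A" using e_div_p[of 0] by (simp add: p_def)
      ultimately show ?thesis by blast
    next
      case True
      then obtain k where k: "x k \<in> M" by blast
      have "\<exists>q\<in>R. \<exists>r\<in>R. q \<notin> M \<and> q * a = e / x k * r" if "a \<in> A" for a
      proof -
        obtain n where "\<exists>r\<in>R. a * p n = e * r" using \<open>a \<in> A\<close> unfolding A_def by blast
        \<comment> \<open>Raising the index to \<open>n + Suc k\<close> ensures that
          \<open>x k\<close> is among the factors and can be split off. The product \<open>q\<close>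
          of the remaining factors is outside \<open>M\<close>.\<close>
        then obtain r where r: "r \<in> R" "a * p (n + Suc k) = e * r" using A_mono by blast
        define q where "q = prod x ({..<n + Suc k} - {k})"
        have "p (n + Suc k) = x k * q"
          unfolding p_def q_def by (rule prod.remove) auto
        then have "q * a = e / x k * r" using r x0[of k] by (simp add: field_simps)
        moreover have "q \<in> R" unfolding q_def by (intro subring_prod x)
        moreover have "q \<notin> M"
          using maximal_ideal_prod[OF M, of "{..<n + Suc k} - {k}" x] x comax[OF M _ k]
          unfolding q_def by blast
        ultimately show ?thesis using r by blast
      qed
      moreover have "e / x k \<in> A"
      proof -
        have "e / x k * p (Suc k) = e * p k" using x0[of k] by (simp add: pSuc)
        then show ?thesis unfolding A_def using p by blast
      qed
      ultimately show ?thesis by blast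
    qed
  qed
  moreover have "A \<noteq> {0}" using e_div_p[of 0] \<open>e \<noteq> 0\<close> by (auto simp: p_def)
  ultimately have "invertible_in R A" using LPI A unfolding LPI_domain_def by blast
  then have "1 \<in> setmult A (colon R A)"
    using subring_closed(2) unfolding invertible_in_def by simp
  then obtain n a b where one: "1 = (\<Sum>i<(n::nat). a i * b i)"
    and ab: "\<And>i. i < n \<Longrightarrow> a i \<in> A" "\<And>i. i < n \<Longrightarrow> b i \<in> colon R A"
    unfolding setmult_def by auto
  have "\<forall>i<n. \<exists>k. \<exists>r\<in>R. a i * p k = e * r" using ab(1) unfolding A_def by blast
  then obtain k where k: "\<And>i. i < n \<Longrightarrow> \<exists>r\<in>R. a i * p (k i) = e * r" by metis
  \<comment> \<open>The sum serves as an upper bound of all the \<open>k i\<close>.\<close>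
  define N where "N = (\<Sum>i<n. k i)"
  have "\<exists>r\<in>R. a i * p N = e * r" if "i < n" for i
    using A_le[OF k[OF that]] that unfolding N_def by (simp add: member_le_sum)
  then obtain r where r: "\<And>i. i < n \<Longrightarrow> r i \<in> R" "\<And>i. i < n \<Longrightarrow> a i * p N = e * r i"
    by metis
  \<comment> \<open>Divide the representation of 1 by \<open>x N\<close>. As
    \<open>a i = r i * e / p N\<close>, the quotient \<open>a i / x N\<close> equals
    \<open>r i * (e / p (Suc N))\<close>, and \<open>b i\<close> carries the element
    \<open>e / p (Suc N)\<close> of \<open>A\<close> into \<open>R\<close>.\<close>
  have "inverse (x N) = (\<Sum>i<n. a i * b i) * inverse (x N)" using one by simp
  also have "\<dots> = (\<Sum>i<n. r i * (b i * (e / p (Suc N))))"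
    unfolding sum_distrib_right
  proof (rule sum.cong[OF refl])
    fix i assume "i \<in> {..<n}"
    then have "a i = e * r i / p N" using r(2)[of i] p0[of N] by (simp add: field_simps)
    then show "a i * b i * inverse (x N) = r i * (b i * (e / p (Suc N)))"
      using x0[of N] p0[of N] by (simp add: pSuc field_simps)
  qed
  also have "\<dots> \<in> R"
  proof (rule ideal_sum)
    show "ideal_of R R" by (auto simp: ideal_of_def intro: subring_closed)
    show "r i * (b i * (e / p (Suc N))) \<in> R" if "i \<in> {..<n}" for i
    proof (rule subring_closed(5))
      show "r i \<in> R" using r(1) that by simp
      show "b i * (e / p (Suc N)) \<in> R"
        using ab(2)[of i] that e_div_p unfolding colon_def by blast
    qed
  qed
  finally have "inverse (x N) \<in> R" .
  obtain M where M: "maximal_ideal R M" "x N \<in> M" using nonunit by blast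
  then have "inverse (x N) * x N \<in> M"
    using \<open>inverse (x N) \<in> R\<close> unfolding maximal_ideal_def ideal_of_def by blast
  then show False using maximal_ideal_one[OF M(1)] x0[of N] by simp
qed

section \<open>Comaximal families from infinitely many maximal ideals\<close>

text \<open>Finitely generated ideals are represented by finite generating sets: a maximal ideal
  contains the ideal exactly when it contains the set, and enlarging the ideal becomes inserting an
  element. Membership in \<open>D\<close> then says that the generated ideal is proper and has
  \<open>d\<close> among its generators.\<close>

lemma infinite_maximal_ideals_comaximal_sets:
  assumes d: "d \<in> R" and inf: "infinite {M. maximal_ideal R M \<and> d \<in> M}"
  obtains F :: "nat \<Rightarrow> 'k set" where
    "\<And>n. finite (F n)" "\<And>n. F n \<subseteq> R" "\<And>n. d \<in> F n"
    "\<And>n. \<exists>M. maximal_ideal R M \<and> F n \<subseteq> M"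
    "\<And>i j M. maximal_ideal R M \<Longrightarrow> F i \<subseteq> M \<Longrightarrow> F j \<subseteq> M \<Longrightarrow> i = j"
proof -
  define D where "D = {F. finite F \<and> d \<in> F \<and> (\<exists>M. maximal_ideal R M \<and> F \<subseteq> M)}"
  define U where "U F \<longleftrightarrow> (\<exists>!M. maximal_ideal R M \<and> F \<subseteq> M)" for F
  have max_sub: "M \<subseteq> R" if "maximal_ideal R M" for M
    using that by (simp add: maximal_ideal_def ideal_of_def)
  have "\<exists>F :: nat \<Rightarrow> 'k set. (\<forall>n. F n \<in> D) \<and>
    (\<forall>i j M. maximal_ideal R M \<longrightarrow> F i \<subseteq> M \<longrightarrow> F j \<subseteq> M \<longrightarrow> i = j)"
  proof (cases "\<forall>F\<in>D. \<exists>G\<in>D. F \<subseteq> G \<and> U G")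
    case True
    define H where "H = {M. maximal_ideal R M \<and>
      (\<exists>G\<in>D. G \<subseteq> M \<and> (\<forall>N. maximal_ideal R N \<longrightarrow> G \<subseteq> N \<longrightarrow> N = M))}"
    \<comment> \<open>Were \<open>H\<close> finite, some maximal \<open>M\<close> containing
      \<open>d\<close> would be outside it. Choosing \<open>y N\<close> in \<open>M\<close> but not
      in \<open>N\<close> for each \<open>N\<close> in \<open>H\<close> gives a finite subset of
      \<open>M\<close>, hence a set in \<open>D\<close>. The unique maximal ideal \<open>N\<close>
      above its enlargement is in \<open>H\<close> and yet contains \<open>y N\<close>.\<close>
    have "infinite H"
    proof
      assume "finite H"
      then obtain M where M: "maximal_ideal R M" "d \<in> M" "M \<notin> H"
        using inf by (metis (mono_tags, lifting) finite_subset mem_Collect_eq subsetI)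
      have "\<exists>y. y \<in> M \<and> y \<notin> N" if "N \<in> H" for N
      proof (rule ccontr)
        assume "\<nexists>y. y \<in> M \<and> y \<notin> N"
        then have "M \<subseteq> N" by blast
        then have "N = M" using M(1) that unfolding H_def maximal_ideal_def by blast
        then show False using M(3) that by blast
      qed
      then obtain y where y: "\<And>N. N \<in> H \<Longrightarrow> y N \<in> M \<and> y N \<notin> N" by metis
      have "insert d (y ` H) \<in> D"
        unfolding D_def using \<open>finite H\<close> M(1,2) y by blast
      then obtain G N where G: "G \<in> D" "insert d (y ` H) \<subseteq> G" "maximal_ideal R N" "G \<subseteq> N"
        "\<And>N'. maximal_ideal R N' \<Longrightarrow> G \<subseteq> N' \<Longrightarrow> N' = N"
        using True unfolding U_def by metis
      then have "N \<in> H" unfolding H_def by blast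
      then show False using y[of N] G by blast
    qed
    then obtain h :: "nat \<Rightarrow> 'k set" where h: "inj h" "range h \<subseteq> H"
      using infinite_countable_subset by blast
    then have "\<forall>n. \<exists>G. G \<in> D \<and> G \<subseteq> h n \<and> (\<forall>N. maximal_ideal R N \<longrightarrow> G \<subseteq> N \<longrightarrow> N = h n)"
      unfolding H_def by blast
    then obtain F where F: "\<And>n. F n \<in> D"
      "\<And>n N. maximal_ideal R N \<Longrightarrow> F n \<subseteq> N \<Longrightarrow> N = h n"
      by metis
    then have "\<forall>i j M. maximal_ideal R M \<longrightarrow> F i \<subseteq> M \<longrightarrow> F j \<subseteq> M \<longrightarrow> i = j"
      using h(1) by (metis injD)
    then show ?thesis using F(1) by blast
  next
    case False
    then obtain F0 where F0: "F0 \<in> D"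
      and two: "\<And>G. G \<in> D \<Longrightarrow> F0 \<subseteq> G \<Longrightarrow> \<not> U G"
      by blast
    \<comment> \<open>Two distinct maximal ideals lie above \<open>G\<close>, and their sum contains
      1 = m + n. Adding \<open>m\<close> to one copy of \<open>G\<close> and \<open>n\<close> to the
      other gives comaximal sets, each still inside one of the two ideals.\<close>
    have split: "\<exists>A B. A \<in> D \<and> B \<in> D \<and> G \<subseteq> A \<and> G \<subseteq> B \<and>
      (\<forall>M. maximal_ideal R M \<longrightarrow> \<not> (A \<subseteq> M \<and> B \<subseteq> M))" if G: "G \<in> D" "F0 \<subseteq> G" for G
    proof -
      obtain M where M: "maximal_ideal R M" "G \<subseteq> M" using G(1) unfolding D_def by blast
      then obtain N where N: "maximal_ideal R N" "G \<subseteq> N" "N \<noteq> M"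
        using two[OF G] unfolding U_def by blast
      have "\<not> N \<subseteq> M" using M(1) N(1,3) unfolding maximal_ideal_def by metis
      moreover have "ideal_of R N" using N(1) by (simp add: maximal_ideal_def)
      ultimately obtain m n where mn: "m \<in> M" "n \<in> N" "m + n = 1"
        using maximal_ideal_add_ideal[OF M(1)] by metis
      have "insert m G \<in> D" "insert n G \<in> D" using G M N mn unfolding D_def by auto
      moreover have "\<not> (insert m G \<subseteq> P \<and> insert n G \<subseteq> P)" if P: "maximal_ideal R P" for P
        using P maximal_ideal_one[OF P] mn(3) unfolding maximal_ideal_def ideal_of_def
        by (metis insert_subset)
      ultimately show ?thesis by blast
    qed
    \<comment> \<open>In a pair (A, B), the set \<open>A\<close> is kept as a member of the family
      while \<open>B\<close> is split again, hence \<open>F0 \<subseteq> B\<close>. Both halves of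
      the next pair contain \<open>B\<close>.\<close>
    define Q where "Q = (\<lambda>(A, B). A \<in> D \<and> B \<in> D \<and> F0 \<subseteq> B \<and>
      (\<forall>M. maximal_ideal R M \<longrightarrow> \<not> (A \<subseteq> M \<and> B \<subseteq> M)))"
    have "\<exists>f :: nat \<Rightarrow> 'k set \<times> 'k set. \<forall>n. Q (f n) \<and>
      (snd (f n) \<subseteq> fst (f (Suc n)) \<and> snd (f n) \<subseteq> snd (f (Suc n)))"
    proof (rule dependent_nat_choice)
      show "\<exists>x. Q x" using split[OF F0] unfolding Q_def by auto
    next
      fix x and n :: nat assume "Q x"
      then show "\<exists>y. Q y \<and> (snd x \<subseteq> fst y \<and> snd x \<subseteq> snd y)"
        using split[of "snd x"] unfolding Q_def by (auto simp: split_beta) blast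
    qed
    then obtain f where Q: "\<And>n. Q (f n)"
      and fst_f: "\<And>n. snd (f n) \<subseteq> fst (f (Suc n))"
      and snd_f: "\<And>n. snd (f n) \<subseteq> snd (f (Suc n))"
      by blast
    have mono: "snd (f i) \<subseteq> snd (f j)" if "i \<le> j" for i j
      using lift_Suc_mono_le[of "\<lambda>n. snd (f n)", OF snd_f that] .
    have lt: "\<not> (fst (f i) \<subseteq> M \<and> fst (f j) \<subseteq> M)"
      if "maximal_ideal R M" "i < j" for i j M
    proof -
      \<comment> \<open>The first component at \<open>j\<close> contains the second component at the
        preceding index \<open>k\<close>, hence the one at \<open>i\<close>, which is comaximal to
        the first component at \<open>i\<close>.\<close>
      obtain k where k: "j = Suc k" "i \<le> k" using \<open>i < j\<close> by (cases j) auto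
      then have "snd (f i) \<subseteq> fst (f j)" using mono fst_f by blast
      moreover have "\<not> (fst (f i) \<subseteq> M \<and> snd (f i) \<subseteq> M)"
        using Q[of i] that(1) unfolding Q_def by (simp add: split_beta)
      ultimately show ?thesis by blast
    qed
    have "\<forall>i j M. maximal_ideal R M \<longrightarrow> fst (f i) \<subseteq> M \<longrightarrow> fst (f j) \<subseteq> M \<longrightarrow> i = j"
      using lt by (metis linorder_neqE_nat)
    moreover have "\<forall>n. fst (f n) \<in> D" using Q unfolding Q_def by (auto simp: split_beta)
    ultimately show ?thesis by (intro exI[of _ "\<lambda>n. fst (f n)"] conjI)
  qed
  then obtain F :: "nat \<Rightarrow> 'k set" where F: "\<And>n. F n \<in> D"
    "\<And>i j M. maximal_ideal R M \<Longrightarrow> F i \<subseteq> M \<Longrightarrow> F j \<subseteq> M \<Longrightarrow> i = j"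
    by blast
  show ?thesis
  proof (rule that[of F])
    show "F n \<subseteq> R" for n using F(1)[of n] max_sub unfolding D_def by blast
  qed (use F in \<open>auto simp: D_def\<close>)
qed

section \<open>Finitely generated ideals and generators over the endomorphism ring\<close>

lemma fg_ideal_span:
  assumes "finite F" "F \<subseteq> R"
  defines "I \<equiv> {\<Sum>g\<in>F. c g * g | c. \<forall>g\<in>F. c g \<in> R}"
  shows "fg_ideal R I" and "F \<subseteq> I" and "\<And>J. ideal_of R J \<Longrightarrow> F \<subseteq> J \<Longrightarrow> I \<subseteq> J"
proof -
  have mem: "(\<Sum>g\<in>F. c g * g) \<in> I" if "\<forall>g\<in>F. c g \<in> R" for c
    using that unfolding I_def by blast
  show least: "I \<subseteq> J" if J: "ideal_of R J" "F \<subseteq> J" for J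
  proof
    fix z assume "z \<in> I"
    then obtain c where "z = (\<Sum>g\<in>F. c g * g)" "\<forall>g\<in>F. c g \<in> R" unfolding I_def by blast
    moreover have "c g * g \<in> J" if "g \<in> F" "c g \<in> R" for g
      using J that unfolding ideal_of_def by blast
    ultimately show "z \<in> J" using ideal_sum[OF J(1), of F "\<lambda>g. c g * g"] by blast
  qed
  have "ideal_of R R" by (auto simp: ideal_of_def intro: subring_closed)
  have "ideal_of R I"
    unfolding ideal_of_def
  proof (intro conjI ballI)
    show "I \<subseteq> R" by (rule least[OF \<open>ideal_of R R\<close> assms(2)])
    show "0 \<in> I" using mem[of "\<lambda>_. 0"] subring_closed(1) by simp
  next
    fix a b assume "a \<in> I" "b \<in> I"
    then obtain c c' where c: "a = (\<Sum>g\<in>F. c g * g)" "\<forall>g\<in>F. c g \<in> R"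
      "b = (\<Sum>g\<in>F. c' g * g)" "\<forall>g\<in>F. c' g \<in> R" unfolding I_def by blast
    then show "a + b \<in> I"
      using mem[of "\<lambda>g. c g + c' g"] by (simp add: sum.distrib distrib_right subring_closed)
  next
    fix r a assume "r \<in> R" "a \<in> I"
    then obtain c where c: "a = (\<Sum>g\<in>F. c g * g)" "\<forall>g\<in>F. c g \<in> R" unfolding I_def by blast
    then show "r * a \<in> I"
      using mem[of "\<lambda>g. r * c g"] \<open>r \<in> R\<close>
      by (simp add: sum_distrib_left mult.assoc subring_closed)
  qed
  then show "fg_ideal R I" unfolding fg_ideal_def I_def using assms(1,2) by blast
  show "F \<subseteq> I"
  proof
    fix g assume "g \<in> F"
    \<comment> \<open>Coefficients 1 at \<open>g\<close> and 0 elsewhere exhibit \<open>g\<close>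
      itself as a combination.\<close>
    then have "(\<Sum>h\<in>F. (if h = g then 1 else 0) * h) = g"
      using \<open>finite F\<close> by (simp add: if_distrib[of "\<lambda>c. c * _"] cong: if_cong)
    then show "g \<in> I" using mem[of "\<lambda>h. if h = g then 1 else 0"] subring_closed(1,2) by simp
  qed
qed

text \<open>From \<open>g = x * e\<close> follows \<open>g * g = x * (e * g)\<close>, and
  \<open>e * g\<close> returns to \<open>I\<close> because \<open>e\<close> is an endomorphism of
  \<open>I\<close>. Principality over \<open>endo I\<close> thus becomes divisibility in
  \<open>R\<close>.\<close>

lemma square_in_principal:
  assumes I: "ideal_of R I" and x: "I = {x * e | e. e \<in> endo I}" and "g \<in> I"
  shows "\<exists>r\<in>R. g * g = x * r"
proof -
  obtain e where e: "g = x * e" "e \<in> endo I" using x \<open>g \<in> I\<close> by blast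
  then have "e * g \<in> I" using \<open>g \<in> I\<close> by (simp add: endo_def colon_def)
  moreover have "g * g = x * (e * g)" using e(1) by (metis mult.assoc)
  ultimately show ?thesis using I unfolding ideal_of_def by blast
qed

end

section \<open>Finite character\<close>

theorem theorem12:
  fixes R :: "'k::field set"
  assumes "is_quotient_field_of R"
    and "R \<noteq> UNIV"
    and "finitely_stable R"
    and "LPI_domain R"
    and "\<forall>I. fg_ideal R I \<and> I \<noteq> {0} \<longrightarrow> (\<exists>x\<in>I. I = {x * e | e. e \<in> endo I})"
  shows "finite_character R"
  unfolding finite_character_def
proof (intro ballI impI, rule ccontr)
  have R: "subring R" using assms(1) by (simp add: is_quotient_field_of_def)
  fix d assume "d \<in> R" "d \<noteq> 0" and inf: "infinite {M. maximal_ideal R M \<and> d \<in> M}"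
  obtain F :: "nat \<Rightarrow> 'k set" where F: "\<And>n. finite (F n)" "\<And>n. F n \<subseteq> R" "\<And>n. d \<in> F n"
    and nonunit: "\<And>n. \<exists>M. maximal_ideal R M \<and> F n \<subseteq> M"
    and comax: "\<And>i j M. maximal_ideal R M \<Longrightarrow> F i \<subseteq> M \<Longrightarrow> F j \<subseteq> M \<Longrightarrow> i = j"
    using infinite_maximal_ideals_comaximal_sets[OF R \<open>d \<in> R\<close> inf] by blast
  \<comment> \<open>The element \<open>x\<close> is the generator over the endomorphism ring of the
    ideal spanned by \<open>F n\<close>. It lies in that ideal, hence in every maximal ideal above
    \<open>F n\<close>.\<close>
  have "\<exists>x\<in>R. (\<forall>g\<in>F n. \<exists>r\<in>R. g * g = x * r) \<and>
    (\<forall>M. maximal_ideal R M \<longrightarrow> F n \<subseteq> M \<longrightarrow> x \<in> M)" for n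
  proof -
    define I where "I = {\<Sum>g\<in>F n. c g * g | c. \<forall>g\<in>F n. c g \<in> R}"
    note span = fg_ideal_span[OF R F(1)[of n] F(2)[of n], folded I_def]
    have "I \<noteq> {0}" using span(2) F(3) \<open>d \<noteq> 0\<close> by blast
    then obtain x where x: "x \<in> I" "I = {x * e | e. e \<in> endo I}" using assms(5) span(1) by blast
    have I: "ideal_of R I" using span(1) by (simp add: fg_ideal_def)
    have "x \<in> R" using x(1) I by (auto simp: ideal_of_def)
    moreover have "\<forall>g\<in>F n. \<exists>r\<in>R. g * g = x * r"
      using square_in_principal[OF R I x(2)] span(2) by blast
    moreover have "\<forall>M. maximal_ideal R M \<longrightarrow> F n \<subseteq> M \<longrightarrow> x \<in> M"
      using span(3) x(1) unfolding maximal_ideal_def by blast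
    ultimately show ?thesis by blast
  qed
  then obtain x where x: "\<And>n. x n \<in> R" "\<And>n g. g \<in> F n \<Longrightarrow> \<exists>r\<in>R. g * g = x n * r"
    "\<And>n M. maximal_ideal R M \<Longrightarrow> F n \<subseteq> M \<Longrightarrow> x n \<in> M"
    by metis
  \<comment> \<open>Conversely, a maximal ideal containing \<open>x n\<close> contains the squares
    of all elements of \<open>F n\<close>, and it is prime. So \<open>x n\<close> inherits
    comaximality from \<open>F n\<close>.\<close>
  have F_sub: "F n \<subseteq> M" if M: "maximal_ideal R M" and "x n \<in> M" for n M
  proof
    fix g assume "g \<in> F n"
    then obtain r where "r \<in> R" "g * g = r * x n" using x(2) by (metis mult.commute)
    then have "g * g \<in> M" using M \<open>x n \<in> M\<close> by (auto simp: maximal_ideal_def ideal_of_def)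
    then show "g \<in> M" using maximal_ideal_prime[OF R M] F(2) \<open>g \<in> F n\<close> by blast
  qed
  show False
  proof (rule LPI_domain_no_comaximal_divisors[OF R assms(4)])
    \<comment> \<open>The common multiple is the square of \<open>d\<close>, because
      \<open>x n\<close> is known to divide squares of elements of \<open>F n\<close>, and
      \<open>d\<close> belongs to every \<open>F n\<close>.\<close>
    show "d * d \<noteq> 0" using \<open>d \<noteq> 0\<close> by simp
    show "\<exists>r\<in>R. d * d = x n * r" for n using x(2) F(3) by blast
    show "\<exists>M. maximal_ideal R M \<and> x n \<in> M" for n using nonunit x(3) by blast
    show "i = j" if "maximal_ideal R M" "x i \<in> M" "x j \<in> M" for i j M
      using comax F_sub that by blast
  qed (rule x(1))
qed

end
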